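(* For every integer $n \ge 3$ we have $g_5(n) \ge 4$.
   Context: For positive integers $n$ and $k \ge 3$, $g_k(n)$ denotes the smallest integer such that for every set $A \subseteq \{1, 2, \ldots, 2n\}$ with $|A| \ge n + g_k(n)$ there exist pairwise distinct integers $b_1, \ldots, b_k$ (arbitrary integers, not required to be positive or to lie in $A$) with $b_i + b_j \in A$ for all $1 \le i < j \le k$. *)

theory Defs
  imports Main
begin

definition has_pairwise_sums :: "nat \<Rightarrow> int set \<Rightarrow> bool" where
  "has_pairwise_sums k A \<longleftrightarrow>
     (\<exists>b :: nat \<Rightarrow> int. inj_on b {1..k} \<and>
        (\<forall>i j. 1 \<le> i \<and> i < j \<and> j \<le> k \<longrightarrow> b i + b j \<in> A))"

definition forces_pairwise_sums :: "nat \<Rightarrow> nat \<Rightarrow> int \<Rightarrow> bool" where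
  "forces_pairwise_sums k n t \<longleftrightarrow>
     (\<forall>A \<subseteq> {1..2 * int n}. int (card A) \<ge> int n + t \<longrightarrow> has_pairwise_sums k A)"

text \<open>The minimum ranges over all integers; for \<open>k \<ge> 2\<close> it is attained, because \<open>t = n + 1\<close>
  satisfies the condition vacuously and \<open>t = - n\<close> violates it with the empty set.\<close>

definition g :: "nat \<Rightarrow> nat \<Rightarrow> int" where
  "g k n = (LEAST t :: int. forces_pairwise_sums k n t)"

end

theory Submission
  imports Defs
begin

text \<open>The set consisting of all odd numbers in \<open>[1, 2n]\<close> and \<open>2, 4, 2n\<close> has \<open>n + 3\<close> elements.
  Among five integers, three have the same parity; their pairwise sums are even and distinct, hence
  are \<open>2, 4, 2n\<close>, so the three are \<open>3 - n, n - 1, n + 1\<close>. Adding one of the other two integers,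
  \<open>u\<close>, to \<open>3 - n\<close> and \<open>n + 1\<close> must give values in \<open>[1, 2n]\<close>, which leaves only \<open>u = n - 2\<close>:
  room for one integer but not for two.\<close>

definition odds_plus :: "int \<Rightarrow> int set" where
  "odds_plus m = {a \<in> {1..2 * m}. odd a} \<union> {2, 4, 2 * m}"

lemma odds_plus_subset: "m \<ge> 2 \<Longrightarrow> odds_plus m \<subseteq> {1..2 * m}"
  by (auto simp: odds_plus_def)

lemma card_odds_plus:
  assumes "n \<ge> 3"
  shows "card (odds_plus (int n)) = n + 3"
proof -
  have odds: "{a \<in> {1..2 * int n}. odd a} = (\<lambda>i. 2 * i + 1) ` {0..<int n}"
    by (auto elim!: oddE)
  have "card {a \<in> {1..2 * int n}. odd a} = n"
    unfolding odds by (subst card_image) (auto simp: inj_on_def)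
  \<comment> \<open>\<open>n \<ge> 3\<close> keeps \<open>2 * int n\<close> apart from 2 and
    4.\<close>
  moreover have "card {2, 4, 2 * int n} = 3"
    using assms by simp
  moreover have "{a \<in> {1..2 * int n}. odd a} \<inter> {2, 4, 2 * int n} = {}"
    by auto
  moreover have "finite {a \<in> {1..2 * int n}. odd a}"
    unfolding odds by simp
  ultimately show ?thesis
    unfolding odds_plus_def by (subst card_Un_disjoint) simp_all
qed

text \<open>Passing to the range of \<open>b\<close> makes the condition symmetric, so elements can
  be chosen without tracking the order of their indices.\<close>

lemma has_pairwise_sumsE:
  assumes "has_pairwise_sums k A"
  obtains B where "card B = k" and "\<And>x y. x \<in> B \<Longrightarrow> y \<in> B \<Longrightarrow> x \<noteq> y \<Longrightarrow> x + y \<in> A"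
proof -
  obtain b :: "nat \<Rightarrow> int" where inj: "inj_on b {1..k}"
    and sums: "\<And>i j. 1 \<le> i \<Longrightarrow> i < j \<Longrightarrow> j \<le> k \<Longrightarrow> b i + b j \<in> A"
    using assms unfolding has_pairwise_sums_def by blast
  have "b i + b j \<in> A" if "i \<in> {1..k}" "j \<in> {1..k}" "b i \<noteq> b j" for i j
    using that sums[of i j] sums[of j i]
    by (cases i j rule: linorder_cases) (auto simp: add.commute)
  then have "x + y \<in> A" if "x \<in> b ` {1..k}" "y \<in> b ` {1..k}" "x \<noteq> y" for x y
    using that by blast
  moreover have "card (b ` {1..k}) = k"
    using inj by (simp add: card_image)
  ultimately show thesis
    using that by blast
qed

text \<open>Pigeonhole on the two parity classes of five integers.\<close>

lemma three_of_same_parity: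
  fixes B :: "int set"
  assumes "card B = 5"
  obtains x y z where "{x, y, z} \<subseteq> B" "x \<noteq> y" "x \<noteq> z" "y \<noteq> z"
    "even (x + y)" "even (x + z)" "even (y + z)"
proof -
  have "finite B"
    using assms card.infinite by force
  then have "card {x \<in> B. even x} + card {x \<in> B. odd x} = card ({x \<in> B. even x} \<union> {x \<in> B. odd x})"
    by (subst card_Un_disjoint) auto
  also have "{x \<in> B. even x} \<union> {x \<in> B. odd x} = B"
    by blast
  finally have "card {x \<in> B. even x} \<ge> 3 \<or> card {x \<in> B. odd x} \<ge> 3"
    using assms by linarith
  then obtain T where "T \<subseteq> {x \<in> B. even x} \<or> T \<subseteq> {x \<in> B. odd x}" "card T = 3"
    by (meson obtain_subset_with_card_n)
  moreover from this(2) obtain x y z where "T = {x, y, z}" "x \<noteq> y" "x \<noteq> z" "y \<noteq> z"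
    by (auto simp: card_3_iff)
  ultimately show thesis
    by (intro that[of x y z]) auto
qed

lemma not_has_pairwise_sums_odds_plus:
  assumes "m \<ge> 3"
  shows "\<not> has_pairwise_sums 5 (odds_plus m)"
proof
  assume "has_pairwise_sums 5 (odds_plus m)"
  then obtain B where card: "card B = 5"
    and sums: "\<And>x y. x \<in> B \<Longrightarrow> y \<in> B \<Longrightarrow> x \<noteq> y \<Longrightarrow> x + y \<in> odds_plus m"
    by (rule has_pairwise_sumsE) blast
  obtain x y z where sub: "{x, y, z} \<subseteq> B" and distinct: "x \<noteq> y" "x \<noteq> z" "y \<noteq> z"
    and even: "even (x + y)" "even (x + z)" "even (y + z)"
    using three_of_same_parity[OF card] .
  have "x + y \<in> {2, 4, 2 * m}" "x + z \<in> {2, 4, 2 * m}" "y + z \<in> {2, 4, 2 * m}"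
    using sums[of x y] sums[of x z] sums[of y z] sub distinct even
    unfolding odds_plus_def by blast+
  \<comment> \<open>Of the 27 assignments of values to the three sums, those with a repeated value
    make two of \<open>x\<close>, \<open>y\<close>, \<open>z\<close> equal; the other six are linear
    systems with this solution up to order.\<close>
  with distinct have triple: "{x, y, z} = {3 - m, m - 1, m + 1}"
    by (elim insertE emptyE) (simp; force)+
  have "u = m - 2" if "u \<in> B - {3 - m, m - 1, m + 1}" for u
  proof -
    \<comment> \<open>The first sum being at least 1 gives \<open>u \<ge> m - 2\<close>, the second
      being at most \<open>2 * m\<close> gives \<open>u \<le> m - 1\<close>, and
      \<open>m - 1\<close> is already taken.\<close>
    have "(3 - m) + u \<in> {1..2 * m}" "(m + 1) + u \<in> {1..2 * m}"
      using sums[of "3 - m" u] sums[of "m + 1" u] sub triple that odds_plus_subset[of m] assms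
      by auto
    then show ?thesis
      using that by auto
  qed
  then have "B \<subseteq> {3 - m, m - 1, m + 1, m - 2}"
    by blast
  then have "card B \<le> card {3 - m, m - 1, m + 1, m - 2}"
    by (intro card_mono) auto
  also have "\<dots> \<le> 4"
    by (simp add: card_insert_if)
  finally show False
    using card by simp
qed

lemma forces_pairwise_sums_ge:
  assumes "n \<ge> 3" "forces_pairwise_sums 5 n t"
  shows "t \<ge> 4"
proof (rule ccontr)
  assume "\<not> t \<ge> 4"
  then have "int (card (odds_plus (int n))) \<ge> int n + t"
    using card_odds_plus[OF assms(1)] by simp
  then show False
    using assms odds_plus_subset[of "int n"] not_has_pairwise_sums_odds_plus[of "int n"]
    unfolding forces_pairwise_sums_def by auto
qed

text \<open>Vacuous, as no \<open>A\<close> has more than \<open>2 * n\<close> elements; it supplies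
  the witness for \<open>int_Least_ge\<close>.\<close>

lemma forces_pairwise_sums_trivial: "forces_pairwise_sums k n (int n + 1)"
proof -
  have "int (card A) < int n + (int n + 1)" if "A \<subseteq> {1..2 * int n}" for A
    using card_mono[OF _ that] by simp
  then show ?thesis
    unfolding forces_pairwise_sums_def by (meson not_le)
qed

text \<open>The integers are not well-ordered, so \<open>LEAST\<close> is meaningful only once a
  minimum is known to exist. The lower bound \<open>c\<close> provides one: shifting by
  \<open>c\<close> reduces to the least natural number.\<close>

lemma int_Least_ge:
  fixes P :: "int \<Rightarrow> bool"
  assumes "P t" and bound: "\<And>s. P s \<Longrightarrow> c \<le> s"
  shows "c \<le> (LEAST s. P s)"
proof -
  define k where "k = (LEAST i. P (c + int i))"
  have "P (c + int (nat (t - c)))"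
    using assms(1) bound[OF assms(1)] by simp
  then have "P (c + int k)"
    unfolding k_def by (rule LeastI)
  moreover have "c + int k \<le> s" if "P s" for s
  proof -
    have "k \<le> nat (s - c)"
      unfolding k_def using that bound[OF that] by (intro Least_le) simp
    then show ?thesis
      using bound[OF that] by simp
  qed
  ultimately have "(LEAST s. P s) = c + int k"
    by (rule Least_equality)
  then show ?thesis
    by simp
qed

theorem theorem6:
  fixes n :: nat
  assumes "n \<ge> 3"
  shows "g 5 n \<ge> 4"
  unfolding g_def
  using forces_pairwise_sums_trivial forces_pairwise_sums_ge[OF assms] by (rule int_Least_ge)

end
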